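(* Let $m,n$ be positive integers and $a,b$ non-negative integers with $a+b=n$ and $a$ even. Let $x_1,\ldots,x_a,y_1,\ldots,y_b$ be complex numbers with $x_1+\cdots+x_a+y_1+\cdots+y_b=0$. Define \[ R_{1,3}(m,n;\tau)= mn\, i^{a}q^{\frac{a}{4}}\sum_{\substack{r_1,\ldots,r_a,s_1,\ldots,s_b\in\mathbb{Z}\\ 2(r_1+\cdots+r_a+s_1+\cdots+s_b)+a=0}}(-1)^{r_1+\cdots+r_a}q^{r_1^2+\cdots+r_a^2+s_1^2+\cdots+s_b^2+r_1+\cdots+r_a}e^{i(2r_1x_1+\cdots+2r_ax_a+2s_1y_1+\cdots+2s_by_b+x_1+\cdots+x_a)}. \] Then for all $z\in\mathbb{C}$, \[ \sum_{k=0}^{mn-1}\prod_{j=1}^{a}\vartheta_1\!\left(z+x_j+\tfrac{k\pi}{mn}\Big|\tau\right)\prod_{i=1}^{b}\vartheta_3\!\left(z+y_i+\tfrac{k\pi}{mn}\Big|\tau\right)=R_{1,3}(m,n;\tau)\,\vartheta_3(mnz\,|\,m^2n\tau). \]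
   Context: Throughout, $\tau\in\mathbb{C}$ with $\Im(\tau)>0$, $q=e^{\pi i\tau}$, and $q^{\alpha}$ means $e^{\pi i\alpha\tau}$ for real $\alpha$. The Jacobi theta functions are $\vartheta_1(z|\tau)=-iq^{1/4}\sum_{n\in\mathbb{Z}}(-1)^nq^{n(n+1)}e^{(2n+1)iz}$, $\vartheta_2(z|\tau)=q^{1/4}\sum_{n\in\mathbb{Z}}q^{n(n+1)}e^{(2n+1)iz}$, $\vartheta_3(z|\tau)=\sum_{n\in\mathbb{Z}}q^{n^2}e^{2niz}$, $\vartheta_4(z|\tau)=\sum_{n\in\mathbb{Z}}(-1)^nq^{n^2}e^{2niz}$; and $\vartheta_j(z|m^2n\tau)$ denotes the same function with $\tau$ replaced by $m^2n\tau$. An empty product equals $1$. *)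

theory Defs
  imports "HOL-Analysis.Analysis"
begin

text \<open>
  \<open>nome_pow \<tau> \<alpha>\<close> is $q^\alpha$ for the nome $q = e^{\pi i \tau}$. It is a function of \<open>\<tau>\<close> rather
  than of \<open>q\<close>, because a principal power of \<open>q\<close> would in general be a different branch.
\<close>
definition nome_pow :: "complex \<Rightarrow> real \<Rightarrow> complex" where
  "nome_pow \<tau> \<alpha> = exp (of_real pi * \<i> * of_real \<alpha> * \<tau>)"

definition jtheta1 :: "complex \<Rightarrow> complex \<Rightarrow> complex" where
  "jtheta1 z \<tau> = - \<i> * nome_pow \<tau> (1/4) *
     (\<Sum>\<^sub>\<infinity>n::int. (-1) powi n * nome_pow \<tau> (of_int (n * (n + 1))) * exp (of_int (2 * n + 1) * \<i> * z))"

definition jtheta3 :: "complex \<Rightarrow> complex \<Rightarrow> complex" where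
  "jtheta3 z \<tau> =
     (\<Sum>\<^sub>\<infinity>n::int. nome_pow \<tau> (of_int (n\<^sup>2)) * exp (2 * of_int n * \<i> * z))"

text \<open>
  Integer tuples $(r_1,\ldots,r_a)$ are extensional functions on \<open>{1..a}\<close>, so that every pair of
  tuples is counted exactly once.
\<close>
definition R13_index :: "nat \<Rightarrow> nat \<Rightarrow> ((nat \<Rightarrow> int) \<times> (nat \<Rightarrow> int)) set" where
  "R13_index a b =
     {(r, s). r \<in> {1..a} \<rightarrow>\<^sub>E UNIV \<and> s \<in> {1..b} \<rightarrow>\<^sub>E UNIV \<and>
              2 * ((\<Sum>j=1..a. r j) + (\<Sum>j=1..b. s j)) + int a = 0}"

definition R13 ::
  "nat \<Rightarrow> nat \<Rightarrow> nat \<Rightarrow> nat \<Rightarrow> (nat \<Rightarrow> complex) \<Rightarrow> (nat \<Rightarrow> complex) \<Rightarrow> complex \<Rightarrow> complex" where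
  "R13 a b m n x y \<tau> =
     of_nat (m * n) * \<i> ^ a * nome_pow \<tau> (of_nat a / 4) *
     (\<Sum>\<^sub>\<infinity>(r, s)\<in>R13_index a b.
        (-1) powi (\<Sum>j=1..a. r j) *
        nome_pow \<tau> (of_int ((\<Sum>j=1..a. (r j)\<^sup>2) + (\<Sum>j=1..b. (s j)\<^sup>2) + (\<Sum>j=1..a. r j))) *
        exp (\<i> * ((\<Sum>j=1..a. 2 * of_int (r j) * x j) + (\<Sum>j=1..b. 2 * of_int (s j) * y j)
                  + (\<Sum>j=1..a. x j))))"

end

theory Submission
  imports Defs
begin

text \<open>
  Expand the product of theta functions into an absolutely convergent sum over all pairs of integer
  tuples \<open>(r, s)\<close>; since \<open>a\<close> is even, the variable \<open>z\<close> enters through \<open>exp (2 \<i> M z)\<close> with the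
  integer \<open>M = \<Sum>r + \<Sum>s + a/2\<close>. Summing over the shifts of \<open>z\<close> by \<open>k \<pi> / (m n)\<close> keeps exactly the
  terms with \<open>M = m n p\<close>, \<open>p\<close> an integer. Subtracting \<open>m p\<close> from every entry reduces these to
  \<open>M = 0\<close>: the linear terms cancel because \<open>M = 0\<close> and the \<open>x\<^sub>j\<close>, \<open>y\<^sub>j\<close> add up to \<open>0\<close>, so only the
  factor \<open>q\<close> to the power \<open>m\<^sup>2 n p\<^sup>2\<close> remains, and the double sum over \<open>(r, s)\<close> and \<open>p\<close> factorises.
\<close>

(* HOL-Analysis declares this infix for two constants; keep the one from Infinite_Sum. *)
no_notation Infinite_Set_Sum.abs_summable_on (infix \<open>abs'_summable'_on\<close> 50)

section \<open>Absolutely convergent sums over pairs and tuples\<close>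

lemma abs_summable_on_times:
  fixes f :: "'a \<Rightarrow> 'c :: {real_normed_div_algebra, banach}" and g :: "'b \<Rightarrow> 'c"
  assumes "f abs_summable_on A" "g abs_summable_on B"
  shows "(\<lambda>(x, y). f x * g y) abs_summable_on A \<times> B"
  unfolding Infinite_Sum.abs_summable_on_Sigma_iff
  using assms
  by (auto simp: norm_mult infsum_cmult_right' abs_mult
      intro!: summable_on_cmult_right summable_on_cmult_left)

lemma infsum_times:
  fixes f :: "'a \<Rightarrow> 'c :: {real_normed_div_algebra, banach}" and g :: "'b \<Rightarrow> 'c"
  assumes "f abs_summable_on A" "g abs_summable_on B"
  shows "(\<Sum>\<^sub>\<infinity>(x, y)\<in>A \<times> B. f x * g y) = infsum f A * infsum g B"
proof -
  have "(\<Sum>\<^sub>\<infinity>x\<in>A. \<Sum>\<^sub>\<infinity>y\<in>B. f x * g y) = (\<Sum>\<^sub>\<infinity>(x, y)\<in>A \<times> B. f x * g y)"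
    using Infinite_Sum.abs_summable_summable[OF abs_summable_on_times[OF assms]]
    by (intro infsum_Sigma'_banach) auto
  then show ?thesis
    by (simp add: infsum_cmult_right' infsum_cmult_left')
qed

text \<open>Induction on the index set: the update \<open>g(i := y)\<close> is a bijection from
  pairs of a new entry and a shorter tuple onto the longer tuples, which reduces the step to the
  two-factor case \<open>abs_summable_on_times\<close>.\<close>

lemma abs_summable_on_prod_PiE:
  fixes f :: "'a \<Rightarrow> 'b \<Rightarrow> 'c :: {real_normed_field, banach}"
  assumes "finite A" and "\<And>x. x \<in> A \<Longrightarrow> f x abs_summable_on B x"
  shows "(\<lambda>g. \<Prod>x\<in>A. f x (g x)) abs_summable_on PiE A B"
  using assms
proof (induction A rule: finite_induct)
  case empty
  then show ?case by simp
next
  case (insert i A)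
  let ?h = "\<lambda>(y, g). g(i := y)"
  have inj: "inj_on ?h (B i \<times> PiE A B)"
    using inj_combinator[OF insert.hyps(2), of B] by simp
  have "(\<lambda>(y, g). f i y * (\<Prod>x\<in>A. f x (g x))) abs_summable_on B i \<times> PiE A B"
    using insert by (intro abs_summable_on_times) auto
  also have "?this \<longleftrightarrow> ((\<lambda>g. norm (\<Prod>x\<in>insert i A. f x (g x))) \<circ> ?h) summable_on B i \<times> PiE A B"
  proof (rule summable_on_cong, clarify)
    fix y g
    have "(\<Prod>x\<in>A. f x ((g(i := y)) x)) = (\<Prod>x\<in>A. f x (g x))"
      using insert.hyps by (intro prod.cong) auto
    with insert.hyps show "norm (f i y * (\<Prod>x\<in>A. f x (g x))) =
        ((\<lambda>g. norm (\<Prod>x\<in>insert i A. f x (g x))) \<circ> ?h) (y, g)"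
      by simp
  qed
  also have "\<dots> \<longleftrightarrow> (\<lambda>g. \<Prod>x\<in>insert i A. f x (g x)) abs_summable_on ?h ` (B i \<times> PiE A B)"
    by (rule summable_on_reindex[OF inj, symmetric])
  also have "?h ` (B i \<times> PiE A B) = PiE (insert i A) B"
    by (rule PiE_insert_eq[symmetric])
  finally show ?case .
qed

lemma infsum_sum_swap:
  fixes f :: "'k \<Rightarrow> 'a \<Rightarrow> 'c :: {topological_comm_monoid_add, t2_space}"
  assumes "finite K" and "\<And>k. k \<in> K \<Longrightarrow> f k summable_on A"
  shows "(\<Sum>k\<in>K. infsum (f k) A) = (\<Sum>\<^sub>\<infinity>x\<in>A. \<Sum>k\<in>K. f k x)"
proof -
  have "((\<lambda>x. \<Sum>k\<in>K. f k x) has_sum (\<Sum>k\<in>K. infsum (f k) A)) A"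
    using assms by (induction K rule: finite_induct) (auto intro!: has_sum_add)
  then show ?thesis by (simp add: infsumI)
qed

section \<open>Gaussian sums and convergence of the theta series\<close>

lemma summable_on_int_exp_minus_abs: "(\<lambda>n::int. exp (- real_of_int \<bar>n\<bar>)) summable_on UNIV"
proof -
  have *: "(\<lambda>n::nat. exp (- real n)) summable_on UNIV"
    using summable_geometric[of "exp (-1 :: real)"]
    by (intro norm_summable_imp_summable_on) (simp flip: exp_of_nat_mult)
  have "(\<lambda>n::int. exp (- real_of_int \<bar>n\<bar>)) summable_on range int"
    using * by (subst summable_on_reindex) (auto simp: o_def)
  moreover have "(\<lambda>n::int. exp (- real_of_int \<bar>n\<bar>)) summable_on range (\<lambda>n. - int n)"
    using * by (subst summable_on_reindex) (auto simp: o_def inj_def)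
  \<comment> \<open>The two ranges overlap in 0, which does not affect summability over the
    union.\<close>
  ultimately have "(\<lambda>n::int. exp (- real_of_int \<bar>n\<bar>)) summable_on (range int \<union> range (\<lambda>n. - int n))"
    by (rule summable_on_union)
  also have "range int \<union> range (\<lambda>n. - int n) = UNIV"
    by (metis (no_types, lifting) UNIV_eq_I UnI1 UnI2 int_cases2 rangeI)
  finally show ?thesis .
qed

lemma summable_on_int_gaussian:
  fixes c d :: real
  assumes "c > 0"
  shows "(\<lambda>n::int. exp (d * of_int n - c * (of_int n)\<^sup>2)) summable_on UNIV"
proof (rule summable_on_comparison_test)
  \<comment> \<open>\<open>?K\<close> is the maximum over real \<open>t\<close> of
    \<open>(\<bar>d\<bar> + 1) * t - c * t\<^sup>2\<close>, found by completing the square. The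
    extra 1 in the slope leaves room for the comparison with
    \<open>exp (- \<bar>n\<bar>)\<close>.\<close>
  let ?K = "(\<bar>d\<bar> + 1)\<^sup>2 / (4 * c)"
  show "(\<lambda>n::int. exp ?K * exp (- real_of_int \<bar>n\<bar>)) summable_on UNIV"
    by (intro summable_on_cmult_right summable_on_int_exp_minus_abs)
  fix n :: int
  define t where "t = real_of_int \<bar>n\<bar>"
  have "0 \<le> c * (t - (\<bar>d\<bar> + 1) / (2 * c))\<^sup>2"
    using assms by simp
  also have "\<dots> = c * t\<^sup>2 - (\<bar>d\<bar> + 1) * t + ?K"
    using assms by (simp add: field_simps power2_eq_square)
  finally have "\<bar>d\<bar> * t - c * t\<^sup>2 \<le> ?K - t"
    by (simp add: algebra_simps)
  moreover have "d * of_int n \<le> \<bar>d\<bar> * t"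
    unfolding t_def by (metis abs_ge_self abs_mult of_int_abs)
  ultimately have "d * of_int n - c * (of_int n)\<^sup>2 \<le> ?K - t"
    by (simp add: t_def)
  then show "exp (d * of_int n - c * (of_int n)\<^sup>2) \<le> exp ?K * exp (- real_of_int \<bar>n\<bar>)"
    by (simp add: t_def flip: exp_add)
qed simp

lemma nome_pow_add: "nome_pow \<tau> (\<alpha> + \<beta>) = nome_pow \<tau> \<alpha> * nome_pow \<tau> \<beta>"
  by (simp add: nome_pow_def algebra_simps flip: exp_add)

lemma nome_pow_sum: "nome_pow \<tau> (\<Sum>j\<in>A. f j) = (\<Prod>j\<in>A. nome_pow \<tau> (f j))"
  by (induction A rule: infinite_finite_induct) (auto simp: nome_pow_add, auto simp: nome_pow_def)

lemma nome_pow_power: "nome_pow \<tau> \<alpha> ^ k = nome_pow \<tau> (of_nat k * \<alpha>)"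
  by (simp add: nome_pow_def mult_ac flip: exp_of_nat_mult)

lemma norm_nome_pow: "norm (nome_pow \<tau> \<alpha>) = exp (- pi * \<alpha> * Im \<tau>)"
  by (simp add: nome_pow_def)

text \<open>The norm of a term has a real quadratic exponent in \<open>n\<close> with leading
  coefficient \<open>- pi * Im \<tau>\<close>, which is negative. The linear part combines the
  \<open>n\<close> from \<open>n * (n + 1)\<close> with the effect of \<open>Im z\<close>; the
  constant \<open>exp (- Im z)\<close> comes from the 1 in \<open>2 * n + 1\<close>.\<close>

lemma jtheta1_terms_abs_summable:
  assumes "Im \<tau> > 0"
  shows "(\<lambda>n::int. (-1) powi n * nome_pow \<tau> (of_int (n * (n + 1))) *
           exp (of_int (2 * n + 1) * \<i> * z)) abs_summable_on UNIV"
proof -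
  have "(\<lambda>n::int. exp (- Im z) * exp ((- pi * Im \<tau> - 2 * Im z) * of_int n - (pi * Im \<tau>) * (of_int n)\<^sup>2))
          summable_on UNIV"
    using assms by (intro summable_on_cmult_right summable_on_int_gaussian) simp
  then show ?thesis
    by (simp add: norm_mult norm_power_int norm_nome_pow algebra_simps power2_eq_square flip: exp_add)
qed

lemma jtheta3_terms_abs_summable:
  assumes "Im \<tau> > 0"
  shows "(\<lambda>n::int. nome_pow \<tau> (of_int (n\<^sup>2)) * exp (2 * of_int n * \<i> * z)) abs_summable_on UNIV"
proof -
  have "(\<lambda>n::int. exp ((- 2 * Im z) * of_int n - (pi * Im \<tau>) * (of_int n)\<^sup>2)) summable_on UNIV"
    using assms by (intro summable_on_int_gaussian) simp
  then show ?thesis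
    by (simp add: norm_mult norm_nome_pow algebra_simps flip: exp_add)
qed

section \<open>Orthogonality of roots of unity\<close>

text \<open>The summands are the powers of an \<open>N\<close>-th root of unity \<open>w\<close>.
  Either \<open>w = 1\<close>, which happens exactly when \<open>N\<close> divides \<open>M\<close>,
  or the geometric sum vanishes because \<open>w ^ N - 1 = 0\<close>.\<close>

lemma sum_exp_roots_of_unity:
  fixes N :: nat and M :: int
  assumes "N > 0"
  shows "(\<Sum>k<N. exp (2 * \<i> * of_int M * (of_nat k * of_real pi / of_nat N))) =
         (if int N dvd M then of_nat N else (0::complex))"
proof -
  define w where "w = exp (2 * \<i> * of_real pi * (of_int M / of_nat N) :: complex)"
  have eq: "exp (2 * \<i> * of_int M * (of_nat k * of_real pi / of_nat N)) = w ^ k" for k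
    by (simp add: w_def mult_ac flip: exp_of_nat_mult)
  have wN: "w ^ N = 1"
  proof -
    have "w ^ N = exp (2 * of_int M * of_real pi * \<i>)"
      using assms by (simp add: w_def mult_ac flip: exp_of_nat_mult)
    then show ?thesis
      using exp_integer_2pi[of "of_int M"] by (simp add: mult_ac)
  qed
  have w1: "w = 1 \<longleftrightarrow> int N dvd M"
  proof -
    have "w = 1 \<longleftrightarrow> (\<exists>l::int. real_of_int M = of_int l * of_nat N)"
      using assms by (auto simp: w_def exp_eq_1 field_simps)
    also have "\<dots> \<longleftrightarrow> (\<exists>l::int. M = l * int N)"
      by (metis (mono_tags, opaque_lifting) of_int_eq_iff of_int_mult of_int_of_nat_eq)
    finally show ?thesis
      by (auto simp: dvd_def mult.commute)
  qed
  show ?thesis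
  proof (cases "w = 1")
    case True
    with w1 show ?thesis unfolding eq by simp
  next
    case False
    with w1 wN show ?thesis unfolding eq by (simp add: geometric_sum)
  qed
qed

section \<open>Expansion of the theta product\<close>

lemma power_int_sum:
  fixes c :: "'a :: field"
  assumes "c \<noteq> 0"
  shows "c powi (\<Sum>j\<in>A. f j) = (\<Prod>j\<in>A. c powi f j)"
  using assms by (induction A rule: infinite_finite_induct) (auto simp: power_int_add)

text \<open>Isolated from \<open>R13\<close> as a function of arbitrary tuples, because the expanded
  product also runs over tuples outside \<open>R13_index\<close>.\<close>

definition R13_term ::
  "nat \<Rightarrow> nat \<Rightarrow> (nat \<Rightarrow> complex) \<Rightarrow> (nat \<Rightarrow> complex) \<Rightarrow> complex \<Rightarrow> (nat \<Rightarrow> int) \<Rightarrow> (nat \<Rightarrow> int) \<Rightarrow> complex"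
  where
  "R13_term a b x y \<tau> r s =
     (-1) powi (\<Sum>j=1..a. r j) *
     nome_pow \<tau> (of_int ((\<Sum>j=1..a. (r j)\<^sup>2) + (\<Sum>j=1..b. (s j)\<^sup>2) + (\<Sum>j=1..a. r j))) *
     exp (\<i> * ((\<Sum>j=1..a. 2 * of_int (r j) * x j) + (\<Sum>j=1..b. 2 * of_int (s j) * y j)
               + (\<Sum>j=1..a. x j)))"

(* For even a, the factor e^(iw) occurs in the expanded product with exponent twice this number. *)
definition frequency :: "nat \<Rightarrow> nat \<Rightarrow> (nat \<Rightarrow> int) \<Rightarrow> (nat \<Rightarrow> int) \<Rightarrow> int" where
  "frequency a b r s = (\<Sum>j=1..a. r j) + (\<Sum>j=1..b. s j) + int (a div 2)"

abbreviation tuple_pairs :: "nat \<Rightarrow> nat \<Rightarrow> ((nat \<Rightarrow> int) \<times> (nat \<Rightarrow> int)) set" where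
  "tuple_pairs a b \<equiv> ({1..a} \<rightarrow>\<^sub>E UNIV) \<times> ({1..b} \<rightarrow>\<^sub>E UNIV)"

text \<open>Collecting exponents: each theta_1 term contributes \<open>2 * r j + 1\<close> copies of
  \<open>\<i> * w\<close> and each theta_3 term \<open>2 * s j\<close>. Since \<open>a\<close> is
  even, the total is twice an integer. The sum of the \<open>r j\<close> in the power of q comes
  from \<open>r j * (r j + 1)\<close>.\<close>

lemma prod_theta_terms_eq:
  assumes "even a"
  shows "(\<Prod>j=1..a. (-1) powi r j * nome_pow \<tau> (of_int (r j * (r j + 1))) *
              exp (of_int (2 * r j + 1) * \<i> * (w + x j))) *
         (\<Prod>j=1..b. nome_pow \<tau> (of_int ((s j)\<^sup>2)) * exp (2 * of_int (s j) * \<i> * (w + y j))) =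
         R13_term a b x y \<tau> r s * exp (2 * \<i> * of_int (frequency a b r s) * w)"
proof -
  have a: "of_nat a = 2 * (of_nat (a div 2) :: complex)"
    using assms by (metis dvd_mult_div_cancel of_nat_mult of_nat_numeral)
  have "(\<Prod>j=1..a. nome_pow \<tau> (of_int (r j * (r j + 1)))) * (\<Prod>j=1..b. nome_pow \<tau> (of_int ((s j)\<^sup>2))) =
        nome_pow \<tau> (of_int ((\<Sum>j=1..a. (r j)\<^sup>2) + (\<Sum>j=1..b. (s j)\<^sup>2) + (\<Sum>j=1..a. r j)))"
    by (simp add: algebra_simps power2_eq_square sum.distrib flip: nome_pow_sum nome_pow_add)
  moreover have "(\<Prod>j=1..a. exp (of_int (2 * r j + 1) * \<i> * (w + x j))) *
        (\<Prod>j=1..b. exp (2 * of_int (s j) * \<i> * (w + y j))) =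
      exp (\<i> * ((\<Sum>j=1..a. 2 * of_int (r j) * x j) + (\<Sum>j=1..b. 2 * of_int (s j) * y j)
               + (\<Sum>j=1..a. x j))) * exp (2 * \<i> * of_int (frequency a b r s) * w)"
    by (simp add: frequency_def a algebra_simps sum.distrib sum_distrib_left sum_distrib_right
        flip: exp_sum exp_add)
  moreover have "(\<Prod>j=1..a. (-1) powi r j) = ((-1) powi (\<Sum>j=1..a. r j) :: complex)"
    by (simp add: power_int_sum)
  moreover have regroup: "S * P * E * (Q * F) = S * (P * Q) * (E * F)" for S P E Q F :: complex
    by simp
  ultimately show ?thesis
    unfolding R13_term_def prod.distrib regroup by (simp only: mult.assoc[symmetric])
qed

lemma R13_term_exp_abs_summable:
  assumes "Im \<tau> > 0" and "even a"
  shows "(\<lambda>(r, s). R13_term a b x y \<tau> r s * exp (2 * \<i> * of_int (frequency a b r s) * w))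
           abs_summable_on tuple_pairs a b"
proof -
  have "(\<lambda>r. \<Prod>j=1..a. (-1) powi r j * nome_pow \<tau> (of_int (r j * (r j + 1))) *
              exp (of_int (2 * r j + 1) * \<i> * (w + x j))) abs_summable_on ({1..a} \<rightarrow>\<^sub>E UNIV)"
    using assms(1) by (intro abs_summable_on_prod_PiE jtheta1_terms_abs_summable) auto
  moreover have "(\<lambda>s. \<Prod>j=1..b. nome_pow \<tau> (of_int ((s j)\<^sup>2)) *
              exp (2 * of_int (s j) * \<i> * (w + y j))) abs_summable_on ({1..b} \<rightarrow>\<^sub>E UNIV)"
    using assms(1) by (intro abs_summable_on_prod_PiE jtheta3_terms_abs_summable) auto
  ultimately show ?thesis
    unfolding prod_theta_terms_eq[OF assms(2), symmetric] by (rule abs_summable_on_times)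
qed

lemma prod_jtheta_eq_infsum:
  assumes "Im \<tau> > 0" and "even a"
  shows "(\<Prod>j=1..a. jtheta1 (w + x j) \<tau>) * (\<Prod>j=1..b. jtheta3 (w + y j) \<tau>) =
         \<i> ^ a * nome_pow \<tau> (of_nat a / 4) *
         (\<Sum>\<^sub>\<infinity>(r, s)\<in>tuple_pairs a b.
            R13_term a b x y \<tau> r s * exp (2 * \<i> * of_int (frequency a b r s) * w))"
proof -
  let ?f = "\<lambda>j n. (-1) powi n * nome_pow \<tau> (of_int (n * (n + 1))) *
              exp (of_int (2 * n + 1) * \<i> * (w + x j))"
  let ?g = "\<lambda>j n. nome_pow \<tau> (of_int (n\<^sup>2)) * exp (2 * of_int n * \<i> * (w + y j))"
  have "(\<Sum>\<^sub>\<infinity>(r, s)\<in>tuple_pairs a b. (\<Prod>j=1..a. ?f j (r j)) * (\<Prod>j=1..b. ?g j (s j))) =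
        (\<Sum>\<^sub>\<infinity>r\<in>{1..a} \<rightarrow>\<^sub>E UNIV. \<Prod>j=1..a. ?f j (r j)) * (\<Sum>\<^sub>\<infinity>s\<in>{1..b} \<rightarrow>\<^sub>E UNIV. \<Prod>j=1..b. ?g j (s j))"
    using assms(1)
    by (intro infsum_times abs_summable_on_prod_PiE
        jtheta1_terms_abs_summable jtheta3_terms_abs_summable) auto
  also have "(\<Sum>\<^sub>\<infinity>r\<in>{1..a} \<rightarrow>\<^sub>E UNIV. \<Prod>j=1..a. ?f j (r j)) = (\<Prod>j=1..a. infsum (?f j) UNIV)"
    using assms(1) by (intro infsum_prod_PiE_abs jtheta1_terms_abs_summable) auto
  also have "(\<Sum>\<^sub>\<infinity>s\<in>{1..b} \<rightarrow>\<^sub>E UNIV. \<Prod>j=1..b. ?g j (s j)) = (\<Prod>j=1..b. infsum (?g j) UNIV)"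
    using assms(1) by (intro infsum_prod_PiE_abs jtheta3_terms_abs_summable) auto
  finally have "(\<Prod>j=1..a. infsum (?f j) UNIV) * (\<Prod>j=1..b. infsum (?g j) UNIV) =
      (\<Sum>\<^sub>\<infinity>(r, s)\<in>tuple_pairs a b.
            R13_term a b x y \<tau> r s * exp (2 * \<i> * of_int (frequency a b r s) * w))"
    unfolding prod_theta_terms_eq[OF assms(2)] by simp
  \<comment> \<open>The constants multiply to \<open>(- \<i>) ^ a\<close>, which equals
    \<open>\<i> ^ a\<close> because \<open>a\<close> is even, and to \<open>a\<close> factors
    q^(1/4).\<close>
  moreover have "(\<Prod>j=1..a. jtheta1 (w + x j) \<tau>) =
      \<i> ^ a * nome_pow \<tau> (of_nat a / 4) * (\<Prod>j=1..a. infsum (?f j) UNIV)"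
    using assms(2) unfolding jtheta1_def prod.distrib
    by (simp add: nome_pow_power)
  ultimately show ?thesis
    by (simp add: jtheta3_def mult.assoc)
qed

section \<open>Translation of all entries by a constant\<close>

text \<open>The restriction to \<open>A\<close> keeps the result extensional, so translating an
  extensional tuple by \<open>c\<close> and then by \<open>- c\<close> gives back the same
  tuple.\<close>

definition shift :: "'a set \<Rightarrow> int \<Rightarrow> ('a \<Rightarrow> int) \<Rightarrow> 'a \<Rightarrow> int" where
  "shift A c r = (\<lambda>j\<in>A. r j + c)"

lemma shift_in_PiE [simp]: "shift A c r \<in> A \<rightarrow>\<^sub>E UNIV"
  by (simp add: shift_def)

lemma shift_shift [simp]: "shift A c (shift A d r) = shift A (d + c) r"
  by (auto simp: shift_def)

lemma shift_0 [simp]: "r \<in> A \<rightarrow>\<^sub>E UNIV \<Longrightarrow> shift A 0 r = r"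
  by (simp add: shift_def PiE_def extensional_restrict)

text \<open>All \<open>a + b\<close> entries move by \<open>c\<close>. For \<open>a + b = n\<close>
  and \<open>c = m * p\<close> the change is \<open>m * n * p\<close>, so exactly the tuples whose
  frequency is a multiple of \<open>m * n\<close> can be moved to frequency 0 by such a
  translation.\<close>

lemma frequency_shift:
  "frequency a b (shift {1..a} c r) (shift {1..b} c s) = frequency a b r s + int (a + b) * c"
  by (simp add: frequency_def shift_def sum.distrib algebra_simps)

lemma R13_index_eq:
  assumes "even a"
  shows "R13_index a b = {(r, s) \<in> tuple_pairs a b. frequency a b r s = 0}"
proof -
  have "int a = 2 * int (a div 2)"
    using assms by presburger
  then show ?thesis
    by (auto simp: R13_index_def frequency_def)
qed

text \<open>The sign changes by (-1)^(a c) = 1, as \<open>a\<close> is even. In the power of q the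
  terms linear in \<open>c\<close> combine to \<open>2 * c * frequency a b r s\<close>, which is 0,
  and only the square of \<open>c\<close> remains. In the exponential the change is
  \<open>2 * c\<close> times the sum of all \<open>x j\<close> and \<open>y j\<close>, again
  0.\<close>

lemma R13_term_shift:
  assumes "even a" and "frequency a b r s = 0"
    and "(\<Sum>j=1..a. x j) + (\<Sum>j=1..b. y j) = 0"
  shows "R13_term a b x y \<tau> (shift {1..a} c r) (shift {1..b} c s) =
         R13_term a b x y \<tau> r s * nome_pow \<tau> (of_int (int (a + b) * c\<^sup>2))"
proof -
  let ?r = "shift {1..a} c r" and ?s = "shift {1..b} c s"
  have a: "int a = 2 * int (a div 2)"
    using assms(1) by presburger
  have sum_r: "(\<Sum>j=1..a. ?r j) = (\<Sum>j=1..a. r j) + int a * c"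
    by (simp add: shift_def sum.distrib)
  have sign: "(-1) powi (\<Sum>j=1..a. ?r j) = ((-1) powi (\<Sum>j=1..a. r j) :: complex)"
    using assms(1) unfolding sum_r by (simp add: power_int_add)
  have "(\<Sum>j=1..a. (?r j)\<^sup>2) + (\<Sum>j=1..b. (?s j)\<^sup>2) + (\<Sum>j=1..a. ?r j) =
      (\<Sum>j=1..a. (r j)\<^sup>2) + (\<Sum>j=1..b. (s j)\<^sup>2) + (\<Sum>j=1..a. r j) + int (a + b) * c\<^sup>2
        + 2 * c * ((\<Sum>j=1..a. r j) + (\<Sum>j=1..b. s j)) + int a * c"
    by (simp add: shift_def sum.distrib power2_sum sum_distrib_left algebra_simps)
  also have "\<dots> = (\<Sum>j=1..a. (r j)\<^sup>2) + (\<Sum>j=1..b. (s j)\<^sup>2) + (\<Sum>j=1..a. r j) + int (a + b) * c\<^sup>2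
      + 2 * c * frequency a b r s"
    using arg_cong[OF a, of "\<lambda>k. k * c"] by (simp add: frequency_def algebra_simps)
  finally have quad: "(\<Sum>j=1..a. (?r j)\<^sup>2) + (\<Sum>j=1..b. (?s j)\<^sup>2) + (\<Sum>j=1..a. ?r j) =
      (\<Sum>j=1..a. (r j)\<^sup>2) + (\<Sum>j=1..b. (s j)\<^sup>2) + (\<Sum>j=1..a. r j) + int (a + b) * c\<^sup>2"
    using assms(2) by simp
  have "(\<Sum>j=1..a. 2 * of_int (?r j) * x j) + (\<Sum>j=1..b. 2 * of_int (?s j) * y j) =
      (\<Sum>j=1..a. 2 * of_int (r j) * x j) + (\<Sum>j=1..b. 2 * of_int (s j) * y j)
        + 2 * of_int c * ((\<Sum>j=1..a. x j) + (\<Sum>j=1..b. y j))"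
    by (simp add: shift_def sum.distrib sum_distrib_left algebra_simps)
  then have lin: "(\<Sum>j=1..a. 2 * of_int (?r j) * x j) + (\<Sum>j=1..b. 2 * of_int (?s j) * y j) =
      (\<Sum>j=1..a. 2 * of_int (r j) * x j) + (\<Sum>j=1..b. 2 * of_int (s j) * y j)"
    using assms(3) by simp
  show ?thesis
    unfolding R13_term_def sign quad lin of_int_add[of _ "int (a + b) * c\<^sup>2"] nome_pow_add
    by (simp only: mult_ac)
qed

section \<open>Summation over the shifts of z and factorisation of the double sum\<close>

theorem theorem1p9:
  fixes m n a b :: nat and x y :: "nat \<Rightarrow> complex" and \<tau> z :: complex
  assumes "Im \<tau> > 0"
    and "m > 0" and "n > 0"
    and "a + b = n" and "even a"
    and "(\<Sum>j=1..a. x j) + (\<Sum>j=1..b. y j) = 0"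
  shows "(\<Sum>k=0..m * n - 1.
            (\<Prod>j=1..a. jtheta1 (z + x j + of_nat k * of_real pi / of_nat (m * n)) \<tau>) *
            (\<Prod>j=1..b. jtheta3 (z + y j + of_nat k * of_real pi / of_nat (m * n)) \<tau>))
         = R13 a b m n x y \<tau> * jtheta3 (of_nat (m * n) * z) (of_nat (m\<^sup>2 * n) * \<tau>)"
proof -
  define N where "N = m * n"
  have N: "N > 0"
    using assms(2,3) by (simp add: N_def)
  define C where "C = (\<lambda>(r, s). R13_term a b x y \<tau> r s)"
  define M where "M = (\<lambda>(r, s). frequency a b r s)"
  define K where "K = \<i> ^ a * nome_pow \<tau> (of_nat a / 4)"
  define u where "u k = (of_nat k * of_real pi / of_nat N :: complex)" for k :: nat
  define T where "T p = nome_pow (of_nat (m\<^sup>2 * n) * \<tau>) (of_int (p\<^sup>2)) *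
      exp (2 * of_int p * \<i> * (of_nat N * z))" for p :: int
  have summable: "(\<lambda>t. C t * exp (2 * \<i> * of_int (M t) * w)) abs_summable_on tuple_pairs a b" for w
    using R13_term_exp_abs_summable[OF assms(1,5), of b x y w]
    by (simp add: C_def M_def case_prod_unfold)

  \<comment> \<open>\<open>N > 0\<close> makes the range \<open>0..m * n - 1\<close> the same as
    \<open>k < N\<close> despite truncated subtraction.\<close>
  have "(\<Sum>k=0..m * n - 1.
            (\<Prod>j=1..a. jtheta1 (z + x j + of_nat k * of_real pi / of_nat (m * n)) \<tau>) *
            (\<Prod>j=1..b. jtheta3 (z + y j + of_nat k * of_real pi / of_nat (m * n)) \<tau>))
      = (\<Sum>k<N. (\<Prod>j=1..a. jtheta1 ((z + u k) + x j) \<tau>) * (\<Prod>j=1..b. jtheta3 ((z + u k) + y j) \<tau>))"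
    using N by (intro sum.cong) (auto simp: u_def add_ac simp flip: N_def)
  also have "\<dots> = (\<Sum>k<N. K * (\<Sum>\<^sub>\<infinity>t\<in>tuple_pairs a b. C t * exp (2 * \<i> * of_int (M t) * (z + u k))))"
    unfolding prod_jtheta_eq_infsum[OF assms(1,5)]
    by (simp add: C_def M_def K_def case_prod_unfold)
  also have "\<dots> = K * (\<Sum>\<^sub>\<infinity>t\<in>tuple_pairs a b. \<Sum>k<N. C t * exp (2 * \<i> * of_int (M t) * (z + u k)))"
    by (subst infsum_sum_swap[symmetric])
      (simp_all only: finite_lessThan sum_distrib_left Infinite_Sum.abs_summable_summable[OF summable])
  \<comment> \<open>The factors \<open>exp (2 * \<i> * of_int (M t) * u k)\<close> sum over
    \<open>k\<close> to \<open>N\<close> or 0. Only pairs with frequency divisible by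
    \<open>N\<close> survive, and their weight \<open>N\<close> becomes the factor
    \<open>m * n\<close> of \<open>R13\<close>.\<close>
  also have "(\<Sum>\<^sub>\<infinity>t\<in>tuple_pairs a b. \<Sum>k<N. C t * exp (2 * \<i> * of_int (M t) * (z + u k))) =
      (\<Sum>\<^sub>\<infinity>t\<in>{t \<in> tuple_pairs a b. int N dvd M t}. of_nat N * (C t * exp (2 * \<i> * of_int (M t) * z)))"
  proof (rule infsum_cong_neutral)
    fix t
    have "(\<Sum>k<N. C t * exp (2 * \<i> * of_int (M t) * (z + u k))) =
        C t * exp (2 * \<i> * of_int (M t) * z) * (\<Sum>k<N. exp (2 * \<i> * of_int (M t) * u k))"
      by (simp add: sum_distrib_left distrib_left exp_add mult_ac)
    also have "\<dots> = C t * exp (2 * \<i> * of_int (M t) * z) * (if int N dvd M t then of_nat N else 0)"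
      unfolding u_def sum_exp_roots_of_unity[OF N] ..
    finally have eq: "(\<Sum>k<N. C t * exp (2 * \<i> * of_int (M t) * (z + u k))) = \<dots>" .
    show "(\<Sum>k<N. C t * exp (2 * \<i> * of_int (M t) * (z + u k))) = 0"
      if "t \<in> tuple_pairs a b - {t \<in> tuple_pairs a b. int N dvd M t}"
      using that unfolding eq by simp
    show "(\<Sum>k<N. C t * exp (2 * \<i> * of_int (M t) * (z + u k))) =
        of_nat N * (C t * exp (2 * \<i> * of_int (M t) * z))"
      if "t \<in> tuple_pairs a b \<inter> {t \<in> tuple_pairs a b. int N dvd M t}"
      using that unfolding eq by simp
  qed auto
  also have "\<dots> = of_nat N *
      (\<Sum>\<^sub>\<infinity>t\<in>{t \<in> tuple_pairs a b. int N dvd M t}. C t * exp (2 * \<i> * of_int (M t) * z))"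
    by (rule infsum_cmult_right')
  also have "(\<Sum>\<^sub>\<infinity>t\<in>{t \<in> tuple_pairs a b. int N dvd M t}. C t * exp (2 * \<i> * of_int (M t) * z)) =
      (\<Sum>\<^sub>\<infinity>(t, p)\<in>R13_index a b \<times> UNIV. C t * T p)"
  proof (rule infsum_reindex_bij_witness[symmetric])
    define sh where "sh c = (\<lambda>(r, s). (shift {1..a} c r, shift {1..b} c s))" for c
    \<comment> \<open>\<open>j\<close> translates a pair of frequency 0 by \<open>m * p\<close>,
      which raises the frequency to \<open>N * p\<close>. The inverse \<open>i\<close> therefore
      recovers \<open>p\<close> as the quotient of the frequency by \<open>N\<close> and undoes the
      translation.\<close>
    define i where "i t = (sh (- (int m * (M t div int N))) t, M t div int N)" for t
    define j where "j = (\<lambda>(t, p). sh (int m * p) t)"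
    have M_sh: "M (sh (int m * p) t) = M t + int N * p" for p t
      unfolding M_def sh_def
      by (simp only: frequency_shift assms(4) case_prod_unfold fst_conv snd_conv)
        (simp add: N_def)
    have idx: "t \<in> R13_index a b \<longleftrightarrow> t \<in> tuple_pairs a b \<and> M t = 0" for t
      unfolding R13_index_eq[OF assms(5)] by (auto simp: M_def)
    have sh_mem: "sh c t \<in> tuple_pairs a b" for c t
      unfolding sh_def case_prod_unfold by (intro SigmaI shift_in_PiE)
    have sh_sh: "sh c (sh d t) = t" if "t \<in> tuple_pairs a b" "d + c = 0" for c d t
      using that unfolding sh_def case_prod_unfold by (cases t) (simp add: mem_Times_iff)
    show "i (j t) = t" if "t \<in> R13_index a b \<times> UNIV" for t
    proof -
      obtain t' p where t: "t = (t', p)" by (rule prod.exhaust)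
      show ?thesis
        using that N by (simp add: t i_def j_def idx M_sh sh_sh)
    qed
    show "j t \<in> {t \<in> tuple_pairs a b. int N dvd M t}" if "t \<in> R13_index a b \<times> UNIV" for t
      using that sh_mem by (auto simp: j_def idx M_sh)
    show "j (i t) = t" if "t \<in> {t \<in> tuple_pairs a b. int N dvd M t}" for t
      using that by (simp add: i_def j_def sh_sh)
    show "i t \<in> R13_index a b \<times> UNIV" if "t \<in> {t \<in> tuple_pairs a b. int N dvd M t}" for t
      using that sh_mem M_sh[of "- (M t div int N)" t] by (simp add: i_def idx)
    show "C (j t) * exp (2 * \<i> * of_int (M (j t)) * z) = (case t of (t, p) \<Rightarrow> C t * T p)"
      if "t \<in> R13_index a b \<times> UNIV" for t
    proof -
      obtain r s p where t: "t = ((r, s), p)" by (metis surj_pair)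
      have M0: "M (r, s) = 0" using that by (simp add: t idx)
      have "C (j t) = C (r, s) * nome_pow \<tau> (of_int (int n * (int m * p)\<^sup>2))"
        using R13_term_shift[OF assms(5) _ assms(6), of r s \<tau> "int m * p"] M0 assms(4)
        by (simp add: t j_def sh_def C_def M_def)
      \<comment> \<open>The identity n (m p)^2 \<tau> = p^2 (m^2 n \<tau>) trades the larger
        exponent for the parameter of the theta function on the right-hand side.\<close>
      also have "nome_pow \<tau> (of_int (int n * (int m * p)\<^sup>2)) =
          nome_pow (of_nat (m\<^sup>2 * n) * \<tau>) (of_int (p\<^sup>2))"
        by (simp add: nome_pow_def power_mult_distrib mult_ac)
      finally have "C (j t) = C (r, s) * nome_pow (of_nat (m\<^sup>2 * n) * \<tau>) (of_int (p\<^sup>2))" .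
      moreover have "M (j t) = int N * p"
        using M0 by (simp add: t j_def M_sh)
      ultimately show ?thesis
        by (simp add: t T_def mult_ac)
    qed
  qed
  also have "\<dots> = (\<Sum>\<^sub>\<infinity>t\<in>R13_index a b. C t) * (\<Sum>\<^sub>\<infinity>p. T p)"
  proof (rule infsum_times)
    have "R13_index a b \<subseteq> tuple_pairs a b"
      by (auto simp: R13_index_def)
    \<comment> \<open>At \<open>w = 0\<close> the exponential factor is 1, so
      \<open>summable\<close> speaks of \<open>C\<close> alone.\<close>
    then show "C abs_summable_on R13_index a b"
      using summable[of 0] by (auto intro: summable_on_subset_banach)
    show "T abs_summable_on UNIV"
      unfolding T_def using assms(1-3) by (intro jtheta3_terms_abs_summable) simp
  qed
  also have "(\<Sum>\<^sub>\<infinity>p. T p) = jtheta3 (of_nat (m * n) * z) (of_nat (m\<^sup>2 * n) * \<tau>)"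
    by (simp add: T_def jtheta3_def N_def)
  finally show ?thesis
    unfolding R13_def R13_term_def[symmetric] C_def K_def N_def by (simp only: mult_ac)
qed

end
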